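(* Let $r,k$ be integers with $r\ge 2$ and $0\le k\le r-1$, and let $H$ be an $r$-graph consisting of exactly two edges which intersect in exactly $k$ vertices. If $n\ge 2r-k$, then $$\phi_H^r(n)=\left\lceil \tfrac12\binom{n}{r}\right\rceil.$$ Moreover, every $r$-graph $G\in\mathcal{K}^r_{n,2}$ is an extremal graph of $H$, and if $\binom{n}{r}\equiv 0\pmod 2$ then $K_n^r$ is also an extremal graph of $H$.
   Context: An $r$-graph is an $r$-uniform hypergraph. For $r$-graphs $G$ and $H$, an $H$-decomposition of $G$ is a partition of the edge set $E(G)$ into parts such that each part is either a single edge or its edges form an $r$-graph isomorphic to $H$. $\phi_H^r(G)$ is the minimum number of parts in an $H$-decomposition of $G$, and $\phi_H^r(n)=\max\{\phi_H^r(G): G \text{ an } r\text{-graph on } n \text{ vertices}\}$. An $r$-graph $G$ on $n$ vertices with $\phi_H^r(G)=\phi_H^r(n)$ is called an extremal graph of $H$. $K_n^r$ denotes the complete $r$-graph on $n$ vertices. For positive integers $n\ge r$ and $k$, let $\ell$ be the unique integer with $0\le \ell\le k-1$ such that $\binom{n}{r}-\ell\equiv k-1\pmod k$; $\mathcal{K}^r_{n,k}$ denotes the family of all $r$-graphs obtained from $K_n^r$ by deleting $\ell$ edges. *)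

theory Defs
  imports
    Complex_Main
    "HOL-Library.Disjoint_Sets"
    "HOL-Library.Ramsey"
    "HOL-Number_Theory.Cong"
begin

type_synonym 'a hypergraph = "'a set \<times> 'a set set"

abbreviation verts :: "'a hypergraph \<Rightarrow> 'a set" where
  "verts G \<equiv> fst G"

abbreviation edges :: "'a hypergraph \<Rightarrow> 'a set set" where
  "edges G \<equiv> snd G"

definition r_graph :: "nat \<Rightarrow> 'a hypergraph \<Rightarrow> bool" where
  "r_graph r G \<longleftrightarrow> finite (verts G) \<and> (\<forall>e\<in>edges G. e \<subseteq> verts G \<and> card e = r)"

definition hypergraph_iso :: "'a hypergraph \<Rightarrow> 'b hypergraph \<Rightarrow> bool" where
  "hypergraph_iso G H \<longleftrightarrow>
     (\<exists>f. bij_betw f (verts G) (verts H) \<and> (`) f ` edges G = edges H)"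

text \<open>The hypergraph formed by a set of edges has the union of these edges as its vertex set.\<close>

definition hypergraph_of_edges :: "'a set set \<Rightarrow> 'a hypergraph" where
  "hypergraph_of_edges F = (\<Union>F, F)"

definition H_decomposition :: "'b hypergraph \<Rightarrow> 'a hypergraph \<Rightarrow> 'a set set set \<Rightarrow> bool" where
  "H_decomposition H G P \<longleftrightarrow>
     partition_on (edges G) P \<and>
     (\<forall>F\<in>P. (\<exists>e. F = {e}) \<or> hypergraph_iso (hypergraph_of_edges F) H)"

definition phi :: "'b hypergraph \<Rightarrow> 'a hypergraph \<Rightarrow> nat" where
  "phi H G = Min {card P | P. H_decomposition H G P}"

text \<open>
  The maximum ranges over hypergraphs with vertices of type \<^typ>\<open>nat\<close>; this is no restriction,
  since every finite hypergraph is isomorphic to one of these and \<^const>\<open>phi\<close> is invariant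
  under isomorphism.
\<close>

definition phi_max :: "nat \<Rightarrow> 'b hypergraph \<Rightarrow> nat \<Rightarrow> nat" where
  "phi_max r H n = Max {phi H G | G :: nat hypergraph. r_graph r G \<and> card (verts G) = n}"

definition extremal_graph :: "nat \<Rightarrow> 'b hypergraph \<Rightarrow> nat \<Rightarrow> 'a hypergraph \<Rightarrow> bool" where
  "extremal_graph r H n G \<longleftrightarrow>
     r_graph r G \<and> card (verts G) = n \<and> phi H G = phi_max r H n"

definition complete_r_graph :: "nat \<Rightarrow> 'a set \<Rightarrow> 'a hypergraph" where
  "complete_r_graph r V = (V, nsets V r)"

definition deleted_count :: "nat \<Rightarrow> nat \<Rightarrow> nat \<Rightarrow> nat" where
  "deleted_count r n k =
     (THE l. l < k \<and> [int (n choose r) - int l = int k - 1] (mod int k))"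

definition K_family :: "nat \<Rightarrow> nat \<Rightarrow> nat \<Rightarrow> 'a hypergraph set" where
  "K_family r n k =
     {(V, edges (complete_r_graph r V) - D) | V D.
        finite V \<and> card V = n \<and>
        D \<subseteq> edges (complete_r_graph r V) \<and> card D = deleted_count r n k}"

end

theory Submission
  imports Defs
begin

text \<open>
  Let \<open>J\<close> be the generalised Johnson graph: its vertices are the \<open>r\<close>-subsets of an \<open>n\<close>-set, two of
  them being adjacent iff they meet in exactly \<open>k\<close> elements. An \<open>H\<close>-decomposition of \<open>G\<close> amounts
  to a matching of \<open>J\<close> induced on the edges of \<open>G\<close>, so it has at least half as many parts as \<open>G\<close>
  has edges. Conversely, a matching of \<open>J\<close> that misses at most one vertex partitions all
  \<open>r\<close>-subsets into \<open>\<lceil>(n choose r) / 2\<rceil>\<close> parts, and the traces of these parts on any \<open>G\<close> form an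
  \<open>H\<close>-decomposition. Such a matching exists by Gallai's lemma, since \<open>J\<close> is vertex-transitive and,
  unless \<open>k = 0\<close> and \<open>n = 2r\<close>, connected; in the exceptional case complementation is a perfect
  matching.
\<close>

section \<open>Maximum matchings in a finite graph and Gallai's lemma\<close>

locale finite_graph =
  fixes X :: "'v set" and E :: "'v set set"
  assumes finite_X: "finite X"
    and edge: "e \<in> E \<Longrightarrow> e \<subseteq> X \<and> card e = 2"
begin

definition matching :: "'v set set \<Rightarrow> bool" where
  "matching M \<longleftrightarrow> M \<subseteq> E \<and> disjoint M"

definition max_matching :: "'v set set \<Rightarrow> bool" where
  "max_matching M \<longleftrightarrow> matching M \<and> (\<forall>N. matching N \<longrightarrow> card N \<le> card M)"

lemma finite_E: "finite E"
  using finite_X edge by (meson Pow_iff finite_Pow_iff finite_subset subsetI)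

lemma finite_matching: "matching M \<Longrightarrow> finite M"
  using finite_E finite_subset unfolding matching_def by blast

lemma Union_matching_subset: "matching M \<Longrightarrow> \<Union>M \<subseteq> X"
  using edge unfolding matching_def by blast

lemma max_matching_exists: "\<exists>M. max_matching M"
proof -
  have "matching {}" by (simp add: matching_def)
  moreover have "\<forall>M. matching M \<longrightarrow> card M < Suc (card E)"
    using card_mono[OF finite_E] by (auto simp: matching_def less_Suc_eq_le)
  ultimately show ?thesis
    using ex_has_greatest_nat[of matching "{}" card "Suc (card E)"] unfolding max_matching_def by blast
qed

lemma card_Union_matching:
  assumes "matching M" shows "card (\<Union>M) = 2 * card M"
proof -
  have M: "M \<subseteq> E" "disjoint M" using assms by (auto simp: matching_def)
  have "card (\<Union>M) = sum card M"
    using M edge finite_X finite_subset by (intro card_Union_disjoint) blast+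
  also have "\<dots> = 2 * card M" using M edge by (simp add: subset_eq)
  finally show ?thesis .
qed

lemma matching_edge_unique:
  "matching M \<Longrightarrow> e \<in> M \<Longrightarrow> f \<in> M \<Longrightarrow> x \<in> e \<Longrightarrow> x \<in> f \<Longrightarrow> e = f"
  unfolding matching_def pairwise_def disjnt_def by blast

lemma matching_insert:
  assumes "matching M" "e \<in> E" "e \<inter> \<Union>M = {}"
  shows "matching (insert e M)"
  using assms by (auto simp: matching_def pairwise_insert disjnt_def)

lemma edge_nonempty: "e \<in> E \<Longrightarrow> e \<noteq> {}"
  using edge by fastforce

text \<open>Otherwise \<open>e\<close> could be added to \<open>M\<close>. For adjacent vertices
  this is the relation of Gallai's argument: no maximum matching misses both.\<close>

lemma max_matching_meets_edge:
  assumes "max_matching M" "e \<in> E"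
  shows "e \<inter> \<Union>M \<noteq> {}"
proof
  assume *: "e \<inter> \<Union>M = {}"
  have m: "matching M" using assms by (simp add: max_matching_def)
  have "e \<notin> M" using * edge_nonempty[OF assms(2)] by blast
  then have "card (insert e M) = Suc (card M)" using finite_matching[OF m] by simp
  moreover have "card (insert e M) \<le> card M"
    using matching_insert[OF m assms(2) *] assms(1) by (auto simp: max_matching_def)
  ultimately show False by simp
qed

text \<open>
  Gallai's exchange argument, in the form that \<open>no maximum matching misses both\<close> is a transitive
  relation: among the maximum matchings missing \<open>w\<close>, one that shares the most edges with \<open>M\<close>
  could be exchanged to share one more.
\<close>

lemma missed_pair_trans:
  assumes uw: "\<And>M. max_matching M \<Longrightarrow> u \<in> \<Union>M \<or> w \<in> \<Union>M"
    and wv: "\<And>M. max_matching M \<Longrightarrow> w \<in> \<Union>M \<or> v \<in> \<Union>M"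
    and w: "\<exists>N. max_matching N \<and> w \<notin> \<Union>N"
    and M: "max_matching M" and "u \<noteq> v"
  shows "u \<in> \<Union>M \<or> v \<in> \<Union>M"
proof (rule ccontr)
  assume "\<not> ?thesis"
  then have u: "u \<notin> \<Union>M" and v: "v \<notin> \<Union>M" by auto
  let ?P = "\<lambda>N. max_matching N \<and> w \<notin> \<Union>N"
  have mM: "matching M" using M by (simp add: max_matching_def)
  obtain N0 where "?P N0" using w by blast
  moreover have "\<forall>N. ?P N \<longrightarrow> card (M \<inter> N) < Suc (card M)"
    using card_mono[OF finite_matching[OF mM]] by (auto simp: less_Suc_eq_le)
  ultimately obtain N where N: "max_matching N" "w \<notin> \<Union>N"
    and Nmax: "\<And>N'. ?P N' \<Longrightarrow> card (M \<inter> N') \<le> card (M \<inter> N)"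
    using ex_has_greatest_nat[of ?P N0 "\<lambda>N. card (M \<inter> N)" "Suc (card M)"] by blast
  have mN: "matching N" using N by (simp add: max_matching_def)
  have uN: "u \<in> \<Union>N" and vN: "v \<in> \<Union>N" using uw[OF N(1)] wv[OF N(1)] N(2) by auto
  have fin: "finite (\<Union>M)" "finite (\<Union>N)"
    using Union_matching_subset mM mN finite_X finite_subset by metis+
  \<comment> \<open>\<open>M\<close> and \<open>N\<close> cover equally many vertices. As
    \<open>N\<close> covers \<open>u\<close> and \<open>v\<close>, which \<open>M\<close> misses,
    \<open>M\<close> covers at least two vertices missed by \<open>N\<close>, and one of them
    differs from \<open>w\<close>.\<close>
  have "card M = card N" using M N(1) mM mN by (simp add: max_matching_def le_antisym)
  then have "card (\<Union>M) = card (\<Union>N)" using card_Union_matching mM mN by simp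
  then have eq: "card (\<Union>M - \<Union>N) = card (\<Union>N - \<Union>M)"
    using fin by (metis card_Diff_subset_Int finite_Int inf_commute)
  have "card {u, v} \<le> card (\<Union>N - \<Union>M)"
    using u v uN vN fin by (intro card_mono) auto
  then have "\<not> \<Union>M - \<Union>N \<subseteq> {w}"
    using eq \<open>u \<noteq> v\<close> card_mono[of "{w}" "\<Union>M - \<Union>N"] by auto
  then obtain x where x: "x \<in> \<Union>M" "x \<notin> \<Union>N" "x \<noteq> w" by blast
  then obtain e where e: "e \<in> M" "x \<in> e" by blast
  have eE: "e \<in> E" using e mM by (auto simp: matching_def)
  obtain y where exy: "e = {x, y}" "x \<noteq> y"
    using edge[OF eE] e(2) by (auto simp: card_2_iff)
  \<comment> \<open>Since \<open>N\<close> is maximum and misses \<open>x\<close>, it must cover the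
    other end of \<open>e\<close>. The edge \<open>f\<close> of \<open>N\<close> at \<open>y\<close>
    is not in \<open>M\<close>, for it would then equal \<open>e\<close>.\<close>
  have yN: "y \<in> \<Union>N" using max_matching_meets_edge[OF N(1) eE] exy x(2) by auto
  then obtain f where f: "f \<in> N" "y \<in> f" by blast
  have fM: "f \<notin> M"
    using matching_edge_unique[OF mM e(1), of f y] e f x(2) exy by blast
  have eN: "e \<notin> N" using e x(2) by blast
  \<comment> \<open>The exchange of \<open>f\<close> for \<open>e\<close> keeps the size and still
    misses \<open>w\<close>, but gains an edge of \<open>M\<close> and loses none, against the
    choice of \<open>N\<close>.\<close>
  let ?N = "insert e (N - {f})"
  have "e \<inter> \<Union>(N - {f}) = {}"
    using matching_edge_unique[OF mN f(1) _ f(2)] exy x(2) by blast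
  moreover have "matching (N - {f})"
    using mN unfolding matching_def by (auto simp: pairwise_def)
  ultimately have m: "matching ?N" using matching_insert eE by blast
  have "card ?N = card N"
    using finite_matching[OF mN] f eN card_Suc_Diff1 by fastforce
  then have "max_matching ?N" using m N(1) by (simp add: max_matching_def)
  moreover have "w \<notin> \<Union>?N" using N(2) exy x(3) yN by auto
  ultimately have "card (M \<inter> ?N) \<le> card (M \<inter> N)" using Nmax by blast
  moreover have "M \<inter> ?N = insert e (M \<inter> N)" using fM e by auto
  ultimately show False using eN finite_matching[OF mM] by simp
qed

text \<open>Induction along a walk from \<open>u\<close>: consecutive vertices are never both
  missed, and \<open>missed_pair_trans\<close> extends this from \<open>u\<close> to the next
  vertex, its middle vertex being missed by some maximum matching.\<close>

lemma gallai_lemma: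
  assumes missed: "\<And>w. w \<in> X \<Longrightarrow> \<exists>N. max_matching N \<and> w \<notin> \<Union>N"
    and connected: "\<And>u v. u \<in> X \<Longrightarrow> v \<in> X \<Longrightarrow> (\<lambda>x y. {x, y} \<in> E)\<^sup>*\<^sup>* u v"
    and M: "max_matching M" and uv: "u \<in> X" "v \<in> X" "u \<noteq> v"
  shows "u \<in> \<Union>M \<or> v \<in> \<Union>M"
proof -
  \<comment> \<open>Membership in \<open>X\<close> is part of the invariant so that
    \<open>missed\<close> applies to the current end of the walk; \<open>u = v\<close> covers the
    start and returns to it.\<close>
  have "v \<in> X \<and> (u = v \<or> (\<forall>M. max_matching M \<longrightarrow> u \<in> \<Union>M \<or> v \<in> \<Union>M))"
    using connected[OF uv(1,2)]
  proof (induction rule: rtranclp_induct)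
    case base
    then show ?case using uv by simp
  next
    case (step y z)
    have z: "z \<in> X" using edge[OF step(2)] by simp
    have yz: "y \<in> \<Union>M \<or> z \<in> \<Union>M" if "max_matching M" for M
      using max_matching_meets_edge[OF that step(2)] by auto
    show ?case
      using missed_pair_trans[of u y z] step(3) missed yz z by blast
  qed
  then show ?thesis using M uv(3) by blast
qed

text \<open>An injective map preserves both disjointness and the number of edges. This serves to
  move a missed vertex to any other place.\<close>

lemma max_matching_image:
  assumes bij: "bij_betw p X X" and pE: "\<And>e. e \<in> E \<Longrightarrow> p ` e \<in> E"
    and M: "max_matching M"
  shows "max_matching ((`) p ` M)"
proof -
  have mM: "matching M" using M by (simp add: max_matching_def)
  have inj: "inj_on p X" using bij by (simp add: bij_betw_def)
  have sub: "\<And>e. e \<in> M \<Longrightarrow> e \<subseteq> X" using Union_matching_subset[OF mM] by blast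
  have "inj_on ((`) p) M"
    using inj sub by (intro inj_onI) (metis inj_on_image_eq_iff)
  then have "card ((`) p ` M) = card M" by (rule card_image)
  moreover have "disjoint ((`) p ` M)"
  proof (rule pairwiseI, clarsimp simp: disjnt_def)
    fix e f assume ef: "e \<in> M" "f \<in> M" "p ` e \<noteq> p ` f"
    then have "e \<inter> f = {}" using mM unfolding matching_def pairwise_def disjnt_def by blast
    then show "p ` e \<inter> p ` f = {}"
      using inj_on_image_Int[OF inj sub[OF ef(1)] sub[OF ef(2)]] by simp
  qed
  ultimately show ?thesis using M pE by (auto simp: max_matching_def matching_def)
qed

text \<open>If a maximum matching misses some vertex, automorphisms turn it into maximum matchings
  missing any prescribed vertex. Gallai's lemma then applies and forbids a second missed
  vertex.\<close>

lemma near_perfect_matching_of_transitive: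
  assumes trans: "\<And>u v. u \<in> X \<Longrightarrow> v \<in> X \<Longrightarrow>
      \<exists>p. bij_betw p X X \<and> (\<forall>e\<in>E. p ` e \<in> E) \<and> p u = v"
    and connected: "\<And>u v. u \<in> X \<Longrightarrow> v \<in> X \<Longrightarrow> (\<lambda>x y. {x, y} \<in> E)\<^sup>*\<^sup>* u v"
  shows "\<exists>M. matching M \<and> card (X - \<Union>M) \<le> 1"
proof -
  obtain M where M: "max_matching M" using max_matching_exists by blast
  have mM: "matching M" using M by (simp add: max_matching_def)
  have "u = v" if u: "u \<in> X - \<Union>M" and v: "v \<in> X - \<Union>M" for u v
  proof (rule ccontr)
    assume "u \<noteq> v"
    have "\<exists>N. max_matching N \<and> w \<notin> \<Union>N" if w: "w \<in> X" for w
    proof -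
      obtain p where p: "bij_betw p X X" "\<forall>e\<in>E. p ` e \<in> E" "p u = w"
        using trans[of u w] w u by blast
      have "w \<notin> \<Union>((`) p ` M)"
      proof
        assume "w \<in> \<Union>((`) p ` M)"
        then obtain x where x: "x \<in> \<Union>M" "p x = p u" using p(3) by force
        then have "x = u"
          using p(1) u Union_matching_subset[OF mM] unfolding bij_betw_def inj_on_def by blast
        then show False using x u by simp
      qed
      then show ?thesis using max_matching_image[OF p(1) _ M] p(2) by blast
    qed
    then show False using gallai_lemma[OF _ connected M] u v \<open>u \<noteq> v\<close> by blast
  qed
  then have "card (X - \<Union>M) \<le> 1"
    using finite_X by (simp add: card_le_Suc0_iff_eq)
  then show ?thesis using mM by blast
qed

end

section \<open>The generalised Johnson graph: symmetry, connectedness, near-perfect matching\<close>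

definition johnson_edges :: "nat \<Rightarrow> nat \<Rightarrow> 'a set \<Rightarrow> 'a set set set" where
  "johnson_edges r k V = {{A, B} | A B. A \<in> nsets V r \<and> B \<in> nsets V r \<and> card (A \<inter> B) = k}"

text \<open>\<open>k < r\<close> excludes loops, since an \<open>r\<close>-set meets itself in
  \<open>r\<close> elements.\<close>

lemma finite_graph_johnson:
  assumes "finite V" "k < r"
  shows "finite_graph (nsets V r) (johnson_edges r k V)"
proof
  show "finite (nsets V r)" using assms(1) by (rule finite_imp_finite_nsets)
next
  fix e assume "e \<in> johnson_edges r k V"
  then obtain A B where AB: "e = {A, B}" "A \<in> nsets V r" "B \<in> nsets V r" "card (A \<inter> B) = k"
    by (auto simp: johnson_edges_def)
  then have "A \<noteq> B" using assms(2) by (auto simp: nsets_def)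
  then show "e \<subseteq> nsets V r \<and> card e = 2" using AB by auto
qed

lemma johnson_edge_iff:
  "{A, B} \<in> johnson_edges r k V \<longleftrightarrow> A \<in> nsets V r \<and> B \<in> nsets V r \<and> card (A \<inter> B) = k"
  by (auto simp: johnson_edges_def doubleton_eq_iff Int_commute)

text \<open>A bijection from \<open>A\<close> to \<open>B\<close> and one between their complements
  combine to a permutation of \<open>V\<close>, and permutations preserve intersection
  sizes.\<close>

lemma johnson_transitive:
  assumes V: "finite V" and AB: "A \<in> nsets V r" "B \<in> nsets V r"
  shows "\<exists>p. bij_betw p (nsets V r) (nsets V r) \<and>
    (\<forall>e\<in>johnson_edges r k V. p ` e \<in> johnson_edges r k V) \<and> p A = B"
proof -
  have sub: "A \<subseteq> V" "B \<subseteq> V" "card A = card B" using AB by (auto simp: nsets_def)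
  have fin: "finite A" "finite B" using sub V finite_subset by auto
  obtain f where f: "bij_betw f A B" using fin sub finite_same_card_bij by blast
  have "card (V - A) = card (V - B)" using sub V fin by (simp add: card_Diff_subset)
  then obtain g where g: "bij_betw g (V - A) (V - B)" using V finite_same_card_bij by blast
  define h where "h = (\<lambda>x. if x \<in> A then f x else g x)"
  have hA: "bij_betw h A B" using f by (subst bij_betw_cong[of _ h f]) (auto simp: h_def)
  have hV: "bij_betw h (V - A) (V - B)" using g by (subst bij_betw_cong[of _ h g]) (auto simp: h_def)
  have "bij_betw h (A \<union> (V - A)) (B \<union> (V - B))"
    using hA hV by (rule bij_betw_combine) auto
  then have h: "bij_betw h V V" using sub by (simp add: Un_absorb1)
  then have inj: "inj_on h V" by (simp add: bij_betw_def)
  have img: "h ` C \<in> nsets V r" if "C \<in> nsets V r" for C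
    using that h card_image[OF inj_on_subset[OF inj]] by (auto simp: nsets_def bij_betw_def)
  have "bij_betw ((`) h) (nsets V r) (nsets V r)"
    by (rule bij_betw_nsets[OF h])
  moreover have "(`) h ` e \<in> johnson_edges r k V" if e: "e \<in> johnson_edges r k V" for e
  proof -
    obtain C D where CD: "e = {C, D}" "C \<in> nsets V r" "D \<in> nsets V r" "card (C \<inter> D) = k"
      using e by (auto simp: johnson_edges_def)
    have s: "C \<subseteq> V" "D \<subseteq> V" using CD by (auto simp: nsets_def)
    have "card (h ` C \<inter> h ` D) = card (h ` (C \<inter> D))"
      using inj_on_image_Int[OF inj s] by simp
    also have "\<dots> = k" using card_image[OF inj_on_subset[OF inj]] s CD(4) by (simp add: le_infI1)
    finally show ?thesis using img CD by (simp add: johnson_edge_iff)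
  qed
  moreover have "h ` A = B" using hA by (simp add: bij_betw_def)
  ultimately show ?thesis by blast
qed

text \<open>The \<open>r\<close>-sets \<open>A\<close> and \<open>insert b (A - {a})\<close> differ
  by one exchange. For \<open>k = 0\<close> take \<open>C\<close> disjoint from both; for
  \<open>k > 0\<close> let \<open>C\<close> contain \<open>a\<close>, \<open>b\<close>,
  \<open>k - 1\<close> common elements and otherwise only elements outside both.\<close>

lemma johnson_common_neighbour:
  assumes V: "finite V" "card V = n" and k: "k < r" "2 * r - k \<le> n"
    and nk: "k = 0 \<Longrightarrow> n \<noteq> 2 * r"
    and A: "A \<in> nsets V r" and a: "a \<in> A" and b: "b \<in> V" "b \<notin> A"
  shows "\<exists>C\<in>nsets V r. card (A \<inter> C) = k \<and> card (insert b (A - {a}) \<inter> C) = k"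
proof -
  have sub: "A \<subseteq> V" "card A = r" and fA: "finite A"
    using A V finite_subset by (auto simp: nsets_def)
  have cI: "card (A - {a}) = r - 1" using a sub fA by simp
  have "card (V - insert b A) = n - Suc r"
    using sub b V fA by (subst card_Diff_subset) auto
  note cO = this
  show ?thesis
  proof (cases "k = 0")
    case True
    \<comment> \<open>This needs \<open>n \<ge> 2 * r + 1\<close>, which is why
      \<open>n = 2 * r\<close> is excluded for \<open>k = 0\<close>.\<close>
    then have "r \<le> card (V - insert b A)" using cO nk k by simp
    then obtain C where C: "C \<subseteq> V - insert b A" "card C = r" "finite C"
      by (rule obtain_subset_with_card_n)
    then have "A \<inter> C = {}" "insert b (A - {a}) \<inter> C = {}" by auto
    then show ?thesis using C True by (intro bexI[of _ C]) (auto simp: nsets_def)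
  next
    case False
    have "k - 1 \<le> card (A - {a})" using cI k by simp
    then obtain S where S: "S \<subseteq> A - {a}" "card S = k - 1" "finite S"
      by (rule obtain_subset_with_card_n)
    \<comment> \<open>\<open>r - k - 1 \<le> n - (r + 1)\<close> is \<open>2 * r - k \<le> n\<close>
      rearranged.\<close>
    have "r - k - 1 \<le> card (V - insert b A)" using cO k by simp
    then obtain T where T: "T \<subseteq> V - insert b A" "card T = r - k - 1" "finite T"
      by (rule obtain_subset_with_card_n)
    let ?C = "insert a (insert b (S \<union> T))"
    have "S \<inter> T = {}" using S T by auto
    then have "card (S \<union> T) = r - 2" using S T k False by (simp add: card_Un_disjoint)
    moreover have "a \<noteq> b" "a \<notin> S \<union> T" "b \<notin> S \<union> T" using a b S T by auto
    ultimately have "card ?C = r" using S T k False by simp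
    then have "?C \<in> nsets V r" using S T a b sub by (auto simp: nsets_def)
    moreover have "A \<inter> ?C = insert a S" "insert b (A - {a}) \<inter> ?C = insert b S"
      using S T a b by auto
    moreover have "card (insert a S) = k" "card (insert b S) = k"
      using S False \<open>a \<notin> S \<union> T\<close> \<open>b \<notin> S \<union> T\<close> by auto
    ultimately show ?thesis by (intro bexI[of _ ?C]) auto
  qed
qed

text \<open>Exchanging an element of \<open>A - B\<close> for one of \<open>B - A\<close> brings
  \<open>A\<close> closer to \<open>B\<close>, and each exchange is a walk of length two through a
  common neighbour.\<close>

lemma johnson_connected:
  assumes V: "finite V" "card V = n" and k: "k < r" "2 * r - k \<le> n"
    and nk: "k = 0 \<Longrightarrow> n \<noteq> 2 * r"
    and "A \<in> nsets V r" "B \<in> nsets V r"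
  shows "(\<lambda>C D. {C, D} \<in> johnson_edges r k V)\<^sup>*\<^sup>* A B"
  using \<open>A \<in> nsets V r\<close>
proof (induction "card (A - B)" arbitrary: A)
  case (0 A)
  then have "finite A" "finite B" "A \<subseteq> B" "card A = card B"
    using \<open>B \<in> nsets V r\<close> by (auto simp: nsets_def)
  then have "A = B" by (simp add: card_subset_eq)
  then show ?case by simp
next
  case (Suc m A)
  have A: "finite A" "A \<subseteq> V" "card A = r" and B: "finite B" "B \<subseteq> V" "card B = r"
    using Suc(3) \<open>B \<in> nsets V r\<close> by (auto simp: nsets_def)
  obtain a where a: "a \<in> A - B" using Suc(2) by (metis card.empty ex_in_conv nat.distinct(1))
  have "\<not> B \<subseteq> A" using a A B card_subset_eq by blast
  then obtain b where b: "b \<in> B" "b \<notin> A" by blast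
  let ?A = "insert b (A - {a})"
  have "card ?A = r" using a A b card_Suc_Diff1[of A a] by auto
  then have A': "?A \<in> nsets V r" using A B b by (auto simp: nsets_def)
  have "?A - B = (A - B) - {a}" using b by auto
  then have "m = card (?A - B)" using Suc(2) a by simp
  then have rest: "(\<lambda>C D. {C, D} \<in> johnson_edges r k V)\<^sup>*\<^sup>* ?A B" using Suc(1) A' by blast
  have "a \<in> A" "b \<in> V" using a b B by auto
  then obtain C where "C \<in> nsets V r" "card (A \<inter> C) = k" "card (?A \<inter> C) = k"
    using johnson_common_neighbour[OF V k nk Suc(3)] b by blast
  then have "{A, C} \<in> johnson_edges r k V" "{C, ?A} \<in> johnson_edges r k V"
    using Suc(3) A' by (simp_all add: johnson_edge_iff Int_commute)
  then show ?case using rest by (meson converse_rtranclp_into_rtranclp)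
qed

lemma johnson_near_perfect_matching:
  assumes V: "finite V" "card V = n" and k: "k < r" "2 * r - k \<le> n"
  shows "\<exists>M. M \<subseteq> johnson_edges r k V \<and> disjoint M \<and> card (nsets V r - \<Union>M) \<le> 1"
proof (cases "k = 0 \<and> n = 2 * r")
  case True
  \<comment> \<open>With \<open>n = 2 * r\<close> complements are again \<open>r\<close>-sets, and
    with \<open>k = 0\<close> they are neighbours. Either member determines its pair, so the pairs
    are disjoint.\<close>
  let ?M = "{{A, V - A} | A. A \<in> nsets V r}"
  have comp: "V - A \<in> nsets V r" if "A \<in> nsets V r" for A
    using that V True by (auto simp: nsets_def card_Diff_subset)
  have "?M \<subseteq> johnson_edges r k V"
    using comp True by (fastforce simp: johnson_edge_iff)
  moreover have "disjoint ?M"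
    by (rule pairwiseI) (auto simp: disjnt_def nsets_def double_diff)
  moreover have "nsets V r - \<Union>?M = {}" by auto
  then have "card (nsets V r - \<Union>?M) \<le> 1" by (simp only: card.empty zero_le)
  ultimately show ?thesis by blast
next
  case False
  interpret finite_graph "nsets V r" "johnson_edges r k V"
    using V k by (intro finite_graph_johnson)
  have "\<exists>M. matching M \<and> card (nsets V r - \<Union>M) \<le> 1"
  proof (rule near_perfect_matching_of_transitive)
    show "(\<lambda>C D. {C, D} \<in> johnson_edges r k V)\<^sup>*\<^sup>* A B"
      if "A \<in> nsets V r" "B \<in> nsets V r" for A B
      using johnson_connected[OF V k _ that] False by blast
  qed (rule johnson_transitive[OF V(1)])
  then show ?thesis by (simp add: matching_def conj_assoc)
qed

lemma johnson_near_perfect_partition: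
  assumes V: "finite V" "card V = n" and k: "k < r" "2 * r - k \<le> n"
  shows "\<exists>Q. partition_on (nsets V r) Q \<and> card Q \<le> ((n choose r) + 1) div 2 \<and>
    (\<forall>F\<in>Q. (\<exists>e. F = {e}) \<or> F \<in> johnson_edges r k V)"
proof -
  interpret finite_graph "nsets V r" "johnson_edges r k V"
    using V k by (intro finite_graph_johnson)
  obtain M where M: "matching M" "card (nsets V r - \<Union>M) \<le> 1"
    using johnson_near_perfect_matching[OF V k] by (auto simp: matching_def)
  let ?R = "nsets V r - \<Union>M"
  let ?Q = "M \<union> (\<lambda>x. {x}) ` ?R"
  have sub: "\<Union>M \<subseteq> nsets V r" using Union_matching_subset[OF M(1)] .
  have "partition_on (nsets V r) ?Q"
  proof (rule partition_onI)
    show "\<Union>?Q = nsets V r" using sub by auto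
    show "{} \<notin> ?Q" using M(1) edge_nonempty by (auto simp: matching_def)
    show "disjnt p q" if "p \<in> ?Q" "q \<in> ?Q" "p \<noteq> q" for p q
      using that M(1) by (auto simp: matching_def pairwise_def disjnt_def)
  qed
  moreover have "card ?Q \<le> ((n choose r) + 1) div 2"
  proof -
    \<comment> \<open>As \<open>n choose r\<close> is \<open>2 * card M + card ?R\<close> with
      \<open>card ?R \<le> 1\<close>, this sum is half of it rounded up.\<close>
    have "card ?Q \<le> card M + card ?R"
      by (rule order.trans[OF card_Un_le]) (simp add: card_image_le finite_X)
    moreover have "card ?R = (n choose r) - 2 * card M"
      using card_Union_matching[OF M(1)] sub finite_subset[OF sub finite_X] V
      by (simp add: card_Diff_subset card_nsets)
    moreover have "2 * card M \<le> (n choose r)"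
      using card_Union_matching[OF M(1)] card_mono[OF finite_X sub] V by (simp add: card_nsets)
    ultimately show ?thesis using M(2) by linarith
  qed
  moreover have "\<forall>F\<in>?Q. (\<exists>e. F = {e}) \<or> F \<in> johnson_edges r k V"
    using M(1) by (auto simp: matching_def)
  ultimately show ?thesis by blast
qed

section \<open>Isomorphism with the two-edge hypergraph\<close>

text \<open>A pair of finite sets is determined up to bijection by the sizes of its intersection and
  two differences, so three bijections are glued together.\<close>

lemma two_edge_iso:
  assumes fin: "finite A" "finite B" "finite e1" "finite e2"
    and card: "card A = card e1" "card B = card e2" "card (A \<inter> B) = card (e1 \<inter> e2)"
  shows "hypergraph_iso (hypergraph_of_edges {A, B}) (e1 \<union> e2, {e1, e2})"
proof -
  have "card (A - B) = card (e1 - e2)" "card (B - A) = card (e2 - e1)"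
    using assms by (simp_all add: card_Diff_subset_Int Int_commute)
  then obtain f g h where f: "bij_betw f (A \<inter> B) (e1 \<inter> e2)"
    and g: "bij_betw g (A - B) (e1 - e2)" and h: "bij_betw h (B - A) (e2 - e1)"
    using fin card(3) finite_same_card_bij by (metis finite_Diff finite_Int)
  define p where "p x = (if x \<in> A then if x \<in> B then f x else g x else h x)" for x
  have pf: "bij_betw p (A \<inter> B) (e1 \<inter> e2)"
    using f by (subst bij_betw_cong[of _ p f]) (auto simp: p_def)
  have pg: "bij_betw p (A - B) (e1 - e2)"
    using g by (subst bij_betw_cong[of _ p g]) (auto simp: p_def)
  have ph: "bij_betw p (B - A) (e2 - e1)"
    using h by (subst bij_betw_cong[of _ p h]) (auto simp: p_def)
  have pA: "bij_betw p A e1"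
    using bij_betw_combine[OF pf pg] by (simp add: Int_Diff_Un Int_Diff_disjoint)
  have pB: "bij_betw p B e2"
    using bij_betw_combine[OF pf ph]
    by (simp add: Int_commute[of A] Int_commute[of e1] Int_Diff_Un Int_Diff_disjoint)
  have "bij_betw p (A \<union> (B - A)) (e1 \<union> (e2 - e1))"
    using pA ph by (rule bij_betw_combine) auto
  then have "bij_betw p (A \<union> B) (e1 \<union> e2)" by simp
  then show ?thesis
    using pA pB unfolding hypergraph_iso_def hypergraph_of_edges_def
    by (intro exI[of _ p]) (simp add: bij_betw_def)
qed

text \<open>A map injective on vertices is injective on edges. This bounds the size of the parts of
  a decomposition.\<close>

lemma hypergraph_iso_card_edges:
  assumes "hypergraph_iso (hypergraph_of_edges F) H"
  shows "card F = card (edges H)"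
proof -
  obtain f where f: "inj_on f (\<Union>F)" "(`) f ` F = edges H"
    using assms by (auto simp: hypergraph_iso_def hypergraph_of_edges_def bij_betw_def)
  have "inj_on ((`) f) F"
    using f(1) by (intro inj_onI) (metis Union_upper inj_on_image_eq_iff)
  then show ?thesis using f(2) card_image by metis
qed

section \<open>Decompositions and bounds for \<open>phi\<close>\<close>

lemma r_graph_edges_subset: "r_graph r G \<Longrightarrow> edges G \<subseteq> nsets (verts G) r"
  using finite_subset by (fastforce simp: r_graph_def nsets_def)

lemma finite_r_graph_edges: "r_graph r G \<Longrightarrow> finite (edges G)"
  by (metis finite_imp_finite_nsets finite_subset r_graph_def r_graph_edges_subset)

text \<open>Makes the set of sizes in the definition of \<open>phi\<close> nonempty, so that its
  minimum is attained.\<close>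

lemma H_decomposition_singletons: "H_decomposition H G ((\<lambda>e. {e}) ` edges G)"
  by (auto simp: H_decomposition_def partition_on_def disjoint_def)

lemma finite_decomposition_sizes:
  assumes "finite (edges G)"
  shows "finite {card P | P. H_decomposition H G P}"
proof -
  have "{P. H_decomposition H G P} \<subseteq> Pow (Pow (edges G))"
    by (auto simp: H_decomposition_def partition_on_def)
  then have "finite {P. H_decomposition H G P}"
    using assms by (meson finite_Pow_iff finite_subset)
  then show ?thesis by (simp add: setcompr_eq_image)
qed

lemma phi_le:
  assumes "finite (edges G)" "H_decomposition H G P"
  shows "phi H G \<le> card P"
  using finite_decomposition_sizes[OF assms(1), of H] assms(2) unfolding phi_def by (auto intro!: Min_le)

lemma phi_attained:
  assumes "finite (edges G)"
  shows "\<exists>P. H_decomposition H G P \<and> phi H G = card P"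
proof -
  have "phi H G \<in> {card P | P. H_decomposition H G P}"
    unfolding phi_def
    by (rule Min_in[OF finite_decomposition_sizes[OF assms]])
      (use H_decomposition_singletons[of H G] in blast)
  then show ?thesis by blast
qed

text \<open>Every part, a single edge or a copy of \<open>H\<close>, has at most two edges.\<close>

lemma card_edges_le_phi:
  assumes fin: "finite (edges G)" and H: "card (edges H) = 2"
  shows "card (edges G) \<le> 2 * phi H G"
proof -
  obtain P where P: "H_decomposition H G P" "phi H G = card P"
    using phi_attained[OF fin] by blast
  have un: "edges G = \<Union>P" using P(1) by (auto simp: H_decomposition_def partition_on_def)
  have "card F \<le> 2" if "F \<in> P" for F
    using that P(1) hypergraph_iso_card_edges[of F H] H by (fastforce simp: H_decomposition_def)
  then have "sum card P \<le> card P * 2" using sum_bounded_above[of P card 2] by simp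
  then show ?thesis using card_Union_le_sum_card[of P] un P(2) by simp
qed

text \<open>One partition of all \<open>r\<close>-subsets serves every \<open>G\<close>: the trace
  of a pair on \<open>edges G\<close> is the pair itself, a single edge or empty.\<close>

lemma phi_two_edges_le:
  assumes H: "H = (e1 \<union> e2, {e1, e2})" "r_graph r H" "card (e1 \<inter> e2) = k"
    and k: "k < r" "2 * r - k \<le> n"
    and G: "r_graph r G" "card (verts G) = n"
  shows "phi H G \<le> ((n choose r) + 1) div 2"
proof -
  let ?V = "verts G"
  have V: "finite ?V" using G(1) by (simp add: r_graph_def)
  have sub: "edges G \<subseteq> nsets ?V r" using r_graph_edges_subset[OF G(1)] .
  obtain Q where Q: "partition_on (nsets ?V r) Q" "card Q \<le> ((n choose r) + 1) div 2"
    "\<And>F. F \<in> Q \<Longrightarrow> (\<exists>e. F = {e}) \<or> F \<in> johnson_edges r k ?V"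
    using johnson_near_perfect_partition[OF V G(2) k] by blast
  \<comment> \<open>Parts of a partition must be nonempty, so empty traces are dropped.\<close>
  let ?P = "(\<inter>) (edges G) ` Q - {{}}"
  have "partition_on (edges G) ?P"
    using partition_on_restrict[OF Q(1), of "edges G"] sub by (simp add: Int_absorb2)
  moreover have "(\<exists>e. F = {e}) \<or> hypergraph_iso (hypergraph_of_edges F) H" if F: "F \<in> ?P" for F
  proof -
    obtain F' where F': "F' \<in> Q" "F = edges G \<inter> F'" "F \<noteq> {}" using F by blast
    show ?thesis
    proof (cases "\<exists>e. F = {e}")
      case False
      then have "\<not> (\<exists>e. F' = {e})" using F' by blast
      then obtain A B where AB: "F' = {A, B}" "A \<in> nsets ?V r" "B \<in> nsets ?V r" "card (A \<inter> B) = k"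
        using Q(3)[OF F'(1)] by (auto simp: johnson_edges_def)
      have FAB: "F = {A, B}" using False F' AB(1) by blast
      have "finite e1" "finite e2" "card e1 = r" "card e2 = r"
        using H by (auto simp: r_graph_def)
      then have "hypergraph_iso (hypergraph_of_edges {A, B}) (e1 \<union> e2, {e1, e2})"
        using AB H(3) by (intro two_edge_iso) (auto simp: nsets_def)
      then show ?thesis using FAB H(1) by simp
    qed simp
  qed
  ultimately have "H_decomposition H G ?P" by (simp add: H_decomposition_def)
  then have "phi H G \<le> card ?P" using phi_le finite_r_graph_edges[OF G(1)] by blast
  also have "\<dots> \<le> card Q"
  proof -
    have "finite Q" using Q(1) finite_elements finite_imp_finite_nsets[OF V] by blast
    then show ?thesis
      by (metis card_image_le card_mono finite_imageI Diff_subset order_trans)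
  qed
  finally show ?thesis using Q(2) by simp
qed

text \<open>The condition on \<open>card (edges G)\<close> compares halves rounded up, so it admits
  the complete graph and, when \<open>n choose r\<close> is even, also the loss of one edge.\<close>

lemma phi_two_edges_eq:
  assumes H: "H = (e1 \<union> e2, {e1, e2})" "r_graph r H" "card (e1 \<inter> e2) = k" "e1 \<noteq> e2"
    and k: "k < r" "2 * r - k \<le> n"
    and G: "r_graph r G" "card (verts G) = n" "((n choose r) + 1) div 2 \<le> (card (edges G) + 1) div 2"
  shows "phi H G = ((n choose r) + 1) div 2"
proof -
  have "card (edges H) = 2" using H(1,4) by simp
  then have "card (edges G) \<le> 2 * phi H G"
    using card_edges_le_phi finite_r_graph_edges[OF G(1)] by blast
  then show ?thesis using phi_two_edges_le[OF H(1-3) k G(1,2)] G(3) by linarith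
qed

section \<open>The family for \<open>k = 2\<close> and the extremal graphs\<close>

text \<open>For modulus 2 the congruence asks that an odd number of edges remain.\<close>

lemma deleted_count_2: "deleted_count r n 2 = (if even (n choose r) then 1 else 0)"
  unfolding deleted_count_def
proof (rule the_equality)
  show "l = (if even (n choose r) then 1 else 0)"
    if "l < 2 \<and> [int (n choose r) - int l = int 2 - 1] (mod int 2)" for l
  proof -
    have "l = 0 \<or> l = 1" using that by auto
    moreover have "(int (n choose r) - int l) mod 2 = 1"
      using that by (simp add: cong_def)
    ultimately show ?thesis by presburger
  qed
  show "(if even (n choose r) then 1 else 0) < (2::nat) \<and>
    [int (n choose r) - int (if even (n choose r) then 1 else 0) = int 2 - 1] (mod int 2)"
    unfolding cong_def by simp presburger
qed

lemma K_family_2_card_edges: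
  assumes "G \<in> K_family r n 2"
  shows "r_graph r G" "card (verts G) = n"
    "card (edges G) = (n choose r) - (if even (n choose r) then 1 else 0)"
proof -
  obtain V D where G: "G = (V, nsets V r - D)" and V: "finite V" "card V = n"
    and D: "D \<subseteq> nsets V r" "card D = (if even (n choose r) then 1 else 0)"
    using assms by (auto simp: K_family_def complete_r_graph_def deleted_count_2)
  show "r_graph r G" "card (verts G) = n" using G V by (auto simp: r_graph_def nsets_def)
  have "finite D" using D(1) finite_imp_finite_nsets[OF V(1)] finite_subset by blast
  then show "card (edges G) = (n choose r) - (if even (n choose r) then 1 else 0)"
    using G V D by (simp add: card_Diff_subset card_nsets)
qed

theorem theorem1p1:
  fixes r k n :: nat
    and H :: "'b hypergraph"
    and e1 e2 :: "'b set"
  assumes "r \<ge> 2"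
    and "k \<le> r - 1"
    and "r_graph r H"
    and "verts H = e1 \<union> e2"
    and "edges H = {e1, e2}"
    and "e1 \<noteq> e2"
    and "card (e1 \<inter> e2) = k"
    and "n \<ge> 2 * r - k"
  shows "int (phi_max r H n) = \<lceil>1 / 2 * real (n choose r)\<rceil> \<and>
    (\<forall>G :: 'a hypergraph. G \<in> K_family r n 2 \<longrightarrow> extremal_graph r H n G) \<and>
    ([n choose r = 0] (mod 2) \<longrightarrow>
      (\<forall>V :: 'a set. finite V \<and> card V = n \<longrightarrow>
        extremal_graph r H n (complete_r_graph r V)))"
proof -
  let ?C = "n choose r"
  let ?m = "(?C + 1) div 2"
  have H: "H = (e1 \<union> e2, {e1, e2})" using assms(4,5) by (metis prod.collapse)
  have k: "k < r" using assms(1,2) by simp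
  have pos: "0 < ?C" using assms(8) k by simp
  note phi_eq = phi_two_edges_eq[OF H assms(3,7,6) k assms(8)]
  \<comment> \<open>For even \<open>?C\<close> the deleted edge is made up for by rounding up; for
    odd \<open>?C\<close> nothing is deleted.\<close>
  have fam: "?m \<le> ((?C - (if even ?C then 1 else 0)) + 1) div 2"
    using pos by auto
  let ?S = "{phi H G | G :: nat hypergraph. r_graph r G \<and> card (verts G) = n}"
  have le: "x \<le> ?m" if "x \<in> ?S" for x
    using that phi_two_edges_le[OF H assms(3,7) k assms(8)] by blast
  have "complete_r_graph r {..<n} = ({..<n}, nsets {..<n} r)"
    by (simp add: complete_r_graph_def)
  then have "r_graph r (complete_r_graph r {..<n})" "card (verts (complete_r_graph r {..<n})) = n"
    "card (edges (complete_r_graph r {..<n})) = ?C"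
    by (auto simp: r_graph_def nsets_def card_nsets[unfolded nsets_def])
  \<comment> \<open>The complete graph on \<open>{..<n}\<close> attains the upper bound among
    hypergraphs on \<open>nat\<close>, which fixes \<open>phi_max\<close>.\<close>
  then have "?m \<in> ?S"
    using phi_eq[of "complete_r_graph r {..<n}"]
    by (intro CollectI exI[of _ "complete_r_graph r {..<n}"]) simp
  moreover have "finite ?S" using le finite_subset[of ?S "{..?m}"] by blast
  ultimately have max: "phi_max r H n = ?m"
    unfolding phi_max_def using le by (intro Max_eqI) blast+
  have "int ?m = \<lceil>1 / 2 * real ?C\<rceil>" by linarith
  moreover have "extremal_graph r H n G" if "G \<in> K_family r n 2" for G :: "'a hypergraph"
    using K_family_2_card_edges[OF that] phi_eq[of G] fam max by (simp add: extremal_graph_def)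
  moreover have "extremal_graph r H n (complete_r_graph r V)"
    if "finite V" "card V = n" for V :: "'a set"
  proof -
    have "r_graph r (complete_r_graph r V)" "card (edges (complete_r_graph r V)) = ?C"
      using that by (auto simp: r_graph_def complete_r_graph_def nsets_def card_nsets[unfolded nsets_def])
    then show ?thesis
      using that phi_eq[of "complete_r_graph r V"] max
      by (simp add: extremal_graph_def complete_r_graph_def)
  qed
  ultimately show ?thesis using max by simp
qed

end
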